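(* Let $n\ge 0$. For $h\in D_n$ with $h\ge h^*$ put $$F(h)=\sum_{\substack{a, b, c \in D_n \\ h^*\le a,b,c \le h}} re(a|b|c,h)\cdot re(a|b^*|c^*,h)\cdot re(b|a^*|c^*,h)\cdot re(c|a^*|b^*,h).$$ Then $$\lambda_{n+4}=\lambda_n+\sum_{\substack {h\in R_n \\ h^*\le h \\ \ell(h)> 2^{n-1}}}\gamma(h)\cdot F(h),$$ where in the sum each class $[h]\in R_n$ is identified with its representative $h\in D_n$.
   Context: $B=\{0,1\}$ with $0\le 1$, and $B^n$ carries the componentwise partial order. $D_n$ is the set of monotone functions $B^n\to B$ (monotone Boolean functions of $n$ variables), ordered pointwise. Elements of $D_n$ are represented as bit strings of length $2^n$: $D_0=\{0,1\}$, and $g\in D_n$ with $n>0$ is represented as the concatenation $g_0\cdot g_1$ with $g_0,g_1\in D_{n-1}$, $g_0\le g_1$, where $g_i$ is the restriction of $g$ to last coordinate equal to $i$. The dual $x^*\in D_n$ of $x\in D_n$ is obtained by reversing the string and negating all its bits (equivalently, $x^*(v)=\neg x(\neg v)$ for $v\in B^n$, with $\neg v$ the componentwise negation). An element $x$ is self-dual if $x=x^*$, and $\lambda_n$ is the number of self-dual elements of $D_n$. $x|y$ is bitwise or; $re(x,y)=|\{z\in D_n: x\le z\le y\}|$; $\ell(x)$ is the number of ones in the string $x$. The condition $h^*\le a,b,c\le h$ means that each of $a,b,c$ lies between $h^*$ and $h$. Every permutation $\pi\in S_n$ of $\{1,\dots,n\}$ acts on $B^n$ by $\pi(x)=x\circ\pi^{-1}$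 (viewing $x$ as a function $\{1,\dots,n\}\to\{0,1\}$) and on $D_n$ by $\pi(g)=g\circ\pi$. For $f,g\in D_n$, $f\sim g$ if $f=\pi(g)$ for some $\pi\in S_n$. $[f]$ is the equivalence class of $f$, $\gamma(f)=|[f]|$, and $R_n$ is the set of equivalence classes. The representative of a class is its minimal element with respect to the total order on $D_n$ obtained by reading the bit strings as integers. *)

theory Defs
  imports Complex_Main "HOL-Library.FuncSet" "HOL-Combinatorics.Permutations"
begin

text \<open>
  Points of \<open>B\<^sup>n\<close> are functions on \<open>{1..n}\<close> and elements of \<open>D\<^sub>n\<close> are functions on \<open>B\<^sup>n\<close>, both
  extensional (\<open>undefined\<close> outside the domain). All of them agree outside the domain, so the
  pointwise \<open>\<le>\<close> and \<open>sup\<close> of the function type are the componentwise order on \<open>B\<^sup>n\<close>, and the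
  pointwise order and the bitwise or on \<open>D\<^sub>n\<close>. \<open>False\<close> stands for 0 and \<open>True\<close> for 1.
\<close>

type_synonym point = "nat \<Rightarrow> bool"
type_synonym boolfun = "point \<Rightarrow> bool"

definition cube :: "nat \<Rightarrow> point set" where
  "cube n = {1..n} \<rightarrow>\<^sub>E UNIV"

definition mbf :: "nat \<Rightarrow> boolfun set" where
  "mbf n = {g \<in> cube n \<rightarrow>\<^sub>E UNIV. mono_on (cube n) g}"

definition dual :: "nat \<Rightarrow> boolfun \<Rightarrow> boolfun" where
  "dual n g = (\<lambda>v\<in>cube n. \<not> g (\<lambda>i\<in>{1..n}. \<not> v i))"

definition selfdual_number :: "nat \<Rightarrow> nat" where
  "selfdual_number n = card {g \<in> mbf n. dual n g = g}"

definition re :: "nat \<Rightarrow> boolfun \<Rightarrow> boolfun \<Rightarrow> nat" where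
  "re n x y = card {z \<in> mbf n. x \<le> z \<and> z \<le> y}"

text \<open>\<open>cofactor n i g\<close> is the restriction of \<open>g \<in> D\<^sub>n\<^sub>+\<^sub>1\<close> to last coordinate equal to \<open>i\<close>.\<close>

definition cofactor :: "nat \<Rightarrow> bool \<Rightarrow> boolfun \<Rightarrow> boolfun" where
  "cofactor n i g = (\<lambda>v\<in>cube n. g (v(Suc n := i)))"

primrec bits :: "nat \<Rightarrow> boolfun \<Rightarrow> bool list" where
  "bits 0 g = [g (\<lambda>_. undefined)]"
| "bits (Suc n) g = bits n (cofactor n False g) @ bits n (cofactor n True g)"

definition ones :: "nat \<Rightarrow> boolfun \<Rightarrow> nat" where
  "ones n g = count_list (bits n g) True"

text \<open>
  The leftmost bit of the string is the most significant one, while \<open>horner_sum\<close> expects the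
  least significant bit first.
\<close>

definition bits_value :: "nat \<Rightarrow> boolfun \<Rightarrow> nat" where
  "bits_value n g = horner_sum of_bool 2 (rev (bits n g))"

definition permute_point :: "(nat \<Rightarrow> nat) \<Rightarrow> point \<Rightarrow> point" where
  "permute_point \<pi> x = x \<circ> inv \<pi>"

definition permute_fun :: "(nat \<Rightarrow> nat) \<Rightarrow> boolfun \<Rightarrow> boolfun" where
  "permute_fun \<pi> g = g \<circ> permute_point \<pi>"

definition mbf_equiv :: "nat \<Rightarrow> (boolfun \<times> boolfun) set" where
  "mbf_equiv n = {(f, g). f \<in> mbf n \<and> g \<in> mbf n \<and> (\<exists>\<pi>. \<pi> permutes {1..n} \<and> f = permute_fun \<pi> g)}"

definition class_size :: "nat \<Rightarrow> boolfun \<Rightarrow> nat" where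
  "class_size n f = card (mbf_equiv n `` {f})"

definition mbf_classes :: "nat \<Rightarrow> boolfun set set" where
  "mbf_classes n = mbf n // mbf_equiv n"

definition representative :: "nat \<Rightarrow> boolfun set \<Rightarrow> boolfun" where
  "representative n C = arg_min_on (bits_value n) C"

definition F :: "nat \<Rightarrow> boolfun \<Rightarrow> nat" where
  "F n h =
    (let I = {x \<in> mbf n. dual n h \<le> x \<and> x \<le> h} in
     \<Sum>a\<in>I. \<Sum>b\<in>I. \<Sum>c\<in>I.
       re n (sup (sup a b) c) h *
       re n (sup (sup a (dual n b)) (dual n c)) h *
       re n (sup (sup b (dual n a)) (dual n c)) h *
       re n (sup (sup c (dual n a)) (dual n b)) h)"

text \<open>
  The notions defined on functions and on bit strings fit together: strings have length \<open>2\<^sup>n\<close>, and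
  dualising reverses the string and negates its bits.
\<close>

lemma length_bits: "length (bits n g) = 2 ^ n"
  by (induction n arbitrary: g) simp_all

lemma cofactor_dual: "cofactor n i (dual (Suc n) g) = dual n (cofactor n (\<not> i) g)"
proof
  fix v
  show "cofactor n i (dual (Suc n) g) v = dual n (cofactor n (\<not> i) g) v"
  proof (cases "v \<in> cube n")
    case True
    then have 1: "v(Suc n := i) \<in> cube (Suc n)"
      by (auto simp: cube_def PiE_iff extensional_def)
    have 2: "(\<lambda>j\<in>{1..n}. \<not> v j) \<in> cube n"
      by (auto simp: cube_def)
    have "(\<lambda>j\<in>{1..Suc n}. \<not> (v(Suc n := i)) j) = (\<lambda>j\<in>{1..n}. \<not> v j)(Suc n := \<not> i)"
      by (auto simp: fun_eq_iff)
    with True 1 2 show ?thesis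
      by (simp add: cofactor_def dual_def)
  qed (simp add: cofactor_def dual_def)
qed

lemma bits_dual: "bits n (dual n g) = rev (map Not (bits n g))"
proof (induction n arbitrary: g)
  case 0
  have "(\<lambda>_. undefined) \<in> cube 0" "(\<lambda>i\<in>{1..0::nat}. \<not> undefined) = (\<lambda>_. undefined)"
    by (auto simp: cube_def fun_eq_iff)
  then show ?case by (simp add: dual_def)
next
  case (Suc n)
  then show ?case by (simp add: cofactor_dual)
qed

end

theory Submission
  imports Defs
begin

text \<open>
  Restricting the last four coordinates of \<open>g \<in> D\<^sub>n\<^sub>+\<^sub>4\<close> to the sixteen \<open>w \<in> B\<^sup>4\<close> gives a monotone
  family \<open>g\<^sub>w \<in> D\<^sub>n\<close>, and \<open>g\<close> is self-dual iff \<open>g\<close> at the complement of \<open>w\<close> is the dual of \<open>g\<^sub>w\<close>.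
  Reading \<open>w\<close> as a subset of \<open>{1,2,3,4}\<close>, a self-dual \<open>g\<close> is therefore determined by eight
  members of the family: \<open>h\<close> at the full set; \<open>a, b, c\<close> at \<open>{1,2}\<close>, \<open>{1,3}\<close>, \<open>{2,3}\<close>, whose complements
  are the other three pairs; and one function at each of the four triples. Monotonicity says
  that \<open>a, b, c\<close> lie between \<open>h\<^sup>*\<close> and \<open>h\<close> and that the function at a triple lies between the join
  of the functions at its three pairs and \<open>h\<close>; the remaining inequalities are the duals of
  these. Once \<open>h, a, b, c\<close> are chosen the four triples are independent, whence
  \<open>\<lambda>\<^sub>n\<^sub>+\<^sub>4\<close> is the sum of \<open>F(h)\<close> over all \<open>h\<close> with \<open>h\<^sup>* \<le> h\<close> (\<open>selfdual_number_add_4\<close>).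

  The terms with \<open>h = h\<^sup>*\<close> are all equal to 1 and contribute \<open>\<lambda>\<^sub>n\<close> (\<open>F_selfdual\<close>). For \<open>h\<^sup>* \<le> h\<close>,
  the inequality \<open>h \<noteq> h\<^sup>*\<close> is the same as \<open>\<ell>(h) > 2\<^sup>n\<^sup>-\<^sup>1\<close>, because \<open>\<ell>\<close> is strictly monotone and
  \<open>\<ell>(h) + \<ell>(h\<^sup>*) = 2\<^sup>n\<close> (\<open>ones_gt_half_iff\<close>). Permutations of the coordinates are order
  automorphisms of \<open>D\<^sub>n\<close> that commute with the dual, so they preserve \<open>F\<close> and the condition on
  \<open>h\<close> (\<open>F_permute\<close>), and the sum may be collected class by class.
\<close>

section \<open>Order and duality\<close>

definition neg_point :: "nat \<Rightarrow> point \<Rightarrow> point" where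
  "neg_point n v = (\<lambda>i\<in>{1..n}. \<not> v i)"

lemma dual_eq: "dual n g = (\<lambda>v\<in>cube n. \<not> g (neg_point n v))"
  by (simp add: dual_def neg_point_def)

lemma finite_mbf: "finite (mbf n)"
proof -
  have "finite (cube n)"
    unfolding cube_def by (intro finite_PiE) auto
  then have "finite (cube n \<rightarrow>\<^sub>E (UNIV :: bool set))"
    by (intro finite_PiE) auto
  then show ?thesis
    unfolding mbf_def by auto
qed

lemma mbf_extensional: "g \<in> mbf n \<Longrightarrow> g \<in> extensional (cube n)"
  by (auto simp: mbf_def PiE_def)

lemma mbf_mono: "g \<in> mbf n \<Longrightarrow> v \<in> cube n \<Longrightarrow> w \<in> cube n \<Longrightarrow> v \<le> w \<Longrightarrow> g v \<le> g w"
  unfolding mbf_def mono_on_def by blast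

lemma extensional_le_iff:
  fixes f g :: "'a \<Rightarrow> 'b::preorder"
  assumes "f \<in> extensional A" "g \<in> extensional A"
  shows "f \<le> g \<longleftrightarrow> (\<forall>v\<in>A. f v \<le> g v)"
  using assms unfolding le_fun_def extensional_def by (metis (mono_tags, lifting) mem_Collect_eq order_refl)

lemma neg_point_in_cube: "neg_point n v \<in> cube n"
  by (auto simp: cube_def neg_point_def)

lemma neg_point_neg_point: "v \<in> cube n \<Longrightarrow> neg_point n (neg_point n v) = v"
  by (auto simp: cube_def neg_point_def fun_eq_iff PiE_def extensional_def)

lemma dual_extensional: "dual n g \<in> extensional (cube n)"
  by (simp add: dual_def)

lemma dual_dual: "g \<in> extensional (cube n) \<Longrightarrow> dual n (dual n g) = g"
  by (rule extensionalityI[of _ "cube n"])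
    (auto simp: dual_eq neg_point_in_cube neg_point_neg_point)

lemma dual_antimono: "x \<le> y \<Longrightarrow> dual n y \<le> dual n x"
  by (auto simp: dual_def le_fun_def restrict_def)

lemma dual_le_dual_iff:
  assumes "x \<in> extensional (cube n)" "y \<in> extensional (cube n)"
  shows "dual n x \<le> dual n y \<longleftrightarrow> y \<le> x"
  using assms dual_antimono dual_dual by metis

lemma dual_mbf: "g \<in> mbf n \<Longrightarrow> dual n g \<in> mbf n"
proof -
  assume g: "g \<in> mbf n"
  have "mono_on (cube n) (dual n g)"
  proof (rule mono_onI)
    fix v w assume vw: "v \<in> cube n" "w \<in> cube n" "v \<le> w"
    then have "neg_point n w \<le> neg_point n v"
      by (auto simp: le_fun_def neg_point_def)
    then have "g (neg_point n w) \<le> g (neg_point n v)"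
      using mbf_mono[OF g neg_point_in_cube neg_point_in_cube] by blast
    then show "dual n g v \<le> dual n g w"
      using vw by (auto simp: dual_eq)
  qed
  then show ?thesis
    by (auto simp: mbf_def dual_def)
qed

section \<open>Monotone functions as pairs of cofactors\<close>

definition base_point :: "nat \<Rightarrow> point \<Rightarrow> point" where
  "base_point n v = restrict v {1..n}"

text \<open>
  On bit strings this is the concatenation \<open>x \<cdot> y\<close>; it inverts the passage to the two cofactors.
\<close>

definition glue :: "nat \<Rightarrow> boolfun \<Rightarrow> boolfun \<Rightarrow> boolfun" where
  "glue n x y = (\<lambda>v\<in>cube (Suc n). (if v (Suc n) then y else x) (base_point n v))"

lemma upd_in_cube: "v \<in> cube n \<Longrightarrow> v(Suc n := i) \<in> cube (Suc n)"
  by (auto simp: cube_def PiE_iff extensional_def)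

lemma base_point_in_cube: "base_point n v \<in> cube n"
  by (auto simp: cube_def base_point_def)

lemma base_point_upd: "v \<in> cube n \<Longrightarrow> base_point n (v(Suc n := i)) = v"
  by (auto simp: cube_def base_point_def fun_eq_iff PiE_def extensional_def)

lemma upd_base_point: "v \<in> cube (Suc n) \<Longrightarrow> (base_point n v)(Suc n := v (Suc n)) = v"
  by (auto simp: cube_def base_point_def fun_eq_iff PiE_def extensional_def)

lemma cofactor_extensional: "cofactor n i g \<in> extensional (cube n)"
  by (simp add: cofactor_def)

lemma glue_extensional: "glue n x y \<in> extensional (cube (Suc n))"
  by (simp add: glue_def)

lemma cofactor_glue:
  assumes "x \<in> extensional (cube n)" "y \<in> extensional (cube n)"
  shows "cofactor n i (glue n x y) = (if i then y else x)"
  by (rule extensionalityI[of _ "cube n"])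
    (use assms in \<open>auto simp: cofactor_def glue_def upd_in_cube base_point_upd\<close>)

lemma glue_cofactor:
  assumes "g \<in> extensional (cube (Suc n))"
  shows "glue n (cofactor n False g) (cofactor n True g) = g"
proof (rule extensionalityI[OF glue_extensional assms])
  fix v assume v: "v \<in> cube (Suc n)"
  have "glue n (cofactor n False g) (cofactor n True g) v
      = g ((base_point n v)(Suc n := v (Suc n)))"
    using v base_point_in_cube by (auto simp: glue_def cofactor_def)
  then show "glue n (cofactor n False g) (cofactor n True g) v = g v"
    using v by (simp only: upd_base_point)
qed

lemma extensional_Suc_cases:
  assumes "g \<in> extensional (cube (Suc n))"
  obtains x y where "g = glue n x y" "x \<in> extensional (cube n)" "y \<in> extensional (cube n)"
  using assms glue_cofactor cofactor_extensional by metis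

lemma extensional_Suc_Suc_cases:
  assumes "g \<in> extensional (cube (Suc (Suc n)))"
  obtains x0 x1 x2 x3 where
    "x0 \<in> extensional (cube n)" "x1 \<in> extensional (cube n)"
    "x2 \<in> extensional (cube n)" "x3 \<in> extensional (cube n)"
    "g = glue (Suc n) (glue n x0 x1) (glue n x2 x3)"
  using assms by (metis extensional_Suc_cases)

lemma glue_eq_iff:
  assumes "x \<in> extensional (cube n)" "y \<in> extensional (cube n)"
    "x' \<in> extensional (cube n)" "y' \<in> extensional (cube n)"
  shows "glue n x y = glue n x' y' \<longleftrightarrow> x = x' \<and> y = y'"
  using assms cofactor_glue by metis

lemma cofactor_mono: "g \<le> g' \<Longrightarrow> cofactor n i g \<le> cofactor n i g'"
  by (auto simp: cofactor_def le_fun_def restrict_def)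

lemma glue_mono: "x \<le> x' \<Longrightarrow> y \<le> y' \<Longrightarrow> glue n x y \<le> glue n x' y'"
  by (auto simp: glue_def le_fun_def restrict_def)

lemma glue_le_iff:
  assumes "x \<in> extensional (cube n)" "y \<in> extensional (cube n)"
    "x' \<in> extensional (cube n)" "y' \<in> extensional (cube n)"
  shows "glue n x y \<le> glue n x' y' \<longleftrightarrow> x \<le> x' \<and> y \<le> y'"
proof
  assume "glue n x y \<le> glue n x' y'"
  then have "cofactor n i (glue n x y) \<le> cofactor n i (glue n x' y')" for i
    by (rule cofactor_mono)
  from this[of False] this[of True] show "x \<le> x' \<and> y \<le> y'"
    using assms by (simp add: cofactor_glue)
qed (simp add: glue_mono)

lemma dual_glue:
  assumes "x \<in> extensional (cube n)" "y \<in> extensional (cube n)"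
  shows "dual (Suc n) (glue n x y) = glue n (dual n y) (dual n x)"
proof -
  have "cofactor n i (dual (Suc n) (glue n x y)) = (if i then dual n x else dual n y)" for i
    using assms by (simp add: cofactor_dual cofactor_glue)
  then show ?thesis
    using glue_cofactor[OF dual_extensional] by metis
qed

text \<open>
  A step upwards in \<open>B\<^sup>n\<^sup>+\<^sup>1\<close> either moves inside one half of the cube or passes from the lower
  half to the upper one; \<open>x \<le> y\<close> is exactly what the second kind of step needs.
\<close>

lemma glue_mbf_iff:
  assumes x: "x \<in> extensional (cube n)" and y: "y \<in> extensional (cube n)"
  shows "glue n x y \<in> mbf (Suc n) \<longleftrightarrow> x \<in> mbf n \<and> y \<in> mbf n \<and> x \<le> y"
proof
  let ?g = "glue n x y"
  assume "?g \<in> mbf (Suc n)"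
  then have mono: "?g v \<le> ?g w" if "v \<in> cube (Suc n)" "w \<in> cube (Suc n)" "v \<le> w" for v w
    using that by (auto simp: mbf_def mono_on_def)
  have cof: "?g (v(Suc n := i)) = (if i then y else x) v" if "v \<in> cube n" for v i
    using that by (simp add: glue_def upd_in_cube base_point_upd)
  have upd: "v(Suc n := i) \<le> w(Suc n := j)" if "v \<le> w" "i \<le> j" for v w :: point and i j
    using that by (auto simp: le_fun_def)
  have *: "(if i then y else x) v \<le> (if j then y else x) w"
    if "v \<in> cube n" "w \<in> cube n" "v \<le> w" "i \<le> j" for v w i j
    using mono[OF upd_in_cube upd_in_cube upd, of v w i j] that by (simp only: cof)
  have "mono_on (cube n) x" "mono_on (cube n) y"
    using *[of _ _ False False] *[of _ _ True True] by (auto intro!: mono_onI)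
  moreover have "x \<le> y"
    using *[of _ _ False True] by (subst extensional_le_iff[OF x y]) auto
  ultimately show "x \<in> mbf n \<and> y \<in> mbf n \<and> x \<le> y"
    using x y by (auto simp: mbf_def PiE_def)
next
  assume A: "x \<in> mbf n \<and> y \<in> mbf n \<and> x \<le> y"
  have "glue n x y v \<le> glue n x y w"
    if vw: "v \<in> cube (Suc n)" "w \<in> cube (Suc n)" "v \<le> w" for v w
  proof -
    have r: "base_point n v \<le> base_point n w" and s: "v (Suc n) \<le> w (Suc n)"
      using \<open>v \<le> w\<close> by (auto simp: base_point_def le_fun_def)
    have "f (base_point n v) \<le> f (base_point n w)" if "f \<in> mbf n" for f
      using mbf_mono[OF that base_point_in_cube base_point_in_cube r] .
    then have "x (base_point n v) \<le> x (base_point n w)"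
      "y (base_point n v) \<le> y (base_point n w)"
      using A by auto
    moreover have "x u \<le> y u" for u
      using A by (auto simp: le_fun_def)
    ultimately show ?thesis
      using vw s by (auto simp: glue_def)
  qed
  then have "mono_on (cube (Suc n)) (glue n x y)"
    by (rule mono_onI)
  then show "glue n x y \<in> mbf (Suc n)"
    by (simp add: mbf_def PiE_def glue_extensional)
qed

section \<open>Self-dual functions in four more variables\<close>

definition interval :: "nat \<Rightarrow> boolfun \<Rightarrow> boolfun \<Rightarrow> boolfun set" where
  "interval n x y = {z \<in> mbf n. x \<le> z \<and> z \<le> y}"

lemma re_eq_card: "re n x y = card (interval n x y)"
  by (simp add: re_def interval_def)

lemma finite_interval: "finite (interval n x y)"
  using finite_mbf by (simp add: interval_def)

text \<open>
  The sixteen blocks are listed with the last coordinate as the most significant bit; \<open>p, q, r, s\<close>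
  are the functions at the triples \<open>{1,2,3}\<close>, \<open>{1,2,4}\<close>, \<open>{1,3,4}\<close>, \<open>{2,3,4}\<close>.
\<close>

definition assemble :: "nat \<Rightarrow> boolfun \<times> boolfun \<times> boolfun \<times> boolfun \<times>
    boolfun \<times> boolfun \<times> boolfun \<times> boolfun \<Rightarrow> boolfun" where
  "assemble n = (\<lambda>(h, a, b, c, p, q, r, s).
    glue (Suc (Suc (Suc n)))
      (glue (Suc (Suc n))
        (glue (Suc n) (glue n (dual n h) (dual n s)) (glue n (dual n r) a))
        (glue (Suc n) (glue n (dual n q) b) (glue n c p)))
      (glue (Suc (Suc n))
        (glue (Suc n) (glue n (dual n p) (dual n c)) (glue n (dual n b) q))
        (glue (Suc n) (glue n (dual n a) r) (glue n s h))))"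

definition selfdual_data :: "nat \<Rightarrow> (boolfun \<times> boolfun \<times> boolfun \<times> boolfun \<times>
    boolfun \<times> boolfun \<times> boolfun \<times> boolfun) set" where
  "selfdual_data n =
    (SIGMA h : {h \<in> mbf n. dual n h \<le> h}.
     SIGMA a : interval n (dual n h) h. SIGMA b : interval n (dual n h) h.
     SIGMA c : interval n (dual n h) h.
       interval n (sup (sup a b) c) h \<times>
       interval n (sup (sup a (dual n b)) (dual n c)) h \<times>
       interval n (sup (sup b (dual n a)) (dual n c)) h \<times>
       interval n (sup (sup c (dual n a)) (dual n b)) h)"

lemma card_selfdual_data:
  "card (selfdual_data n) = (\<Sum>h | h \<in> mbf n \<and> dual n h \<le> h. F n h)"
  unfolding selfdual_data_def
  by (simp add: card_SigmaI finite_SigmaI finite_mbf finite_interval card_cartesian_product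
      F_def Let_def re_eq_card flip: interval_def) (simp add: interval_def mult.assoc)

text \<open>
  Of the 32 covering relations of \<open>B\<^sup>4\<close>, the sixteen above the middle rank place each triple
  between its pairs and the full set; the other sixteen are their duals. The bounds \<open>h\<^sup>* \<le> a \<le> h\<close>
  in \<open>selfdual_data\<close> follow from them: both \<open>a\<close> and \<open>a\<^sup>*\<close> sit at pairs, each pair lies in some triple,
  so \<open>a \<le> h\<close> and \<open>a\<^sup>* \<le> h\<close>, and the latter is dual to \<open>h\<^sup>* \<le> a\<close>.
\<close>

lemma assemble_mbf_iff:
  assumes "h \<in> extensional (cube n)" "a \<in> extensional (cube n)" "b \<in> extensional (cube n)"
    "c \<in> extensional (cube n)" "p \<in> extensional (cube n)" "q \<in> extensional (cube n)"
    "r \<in> extensional (cube n)" "s \<in> extensional (cube n)"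
  shows "assemble n (h, a, b, c, p, q, r, s) \<in> mbf (Suc (Suc (Suc (Suc n)))) \<longleftrightarrow>
    (h, a, b, c, p, q, r, s) \<in> selfdual_data n"
proof -
  note ext = assms dual_extensional glue_extensional
  have flip: "dual n x \<le> y \<longleftrightarrow> dual n y \<le> x"
    if "x \<in> extensional (cube n)" "y \<in> extensional (cube n)" for x y
    using that dual_antimono dual_dual by metis
  have flip': "x \<le> dual n y \<longleftrightarrow> y \<le> dual n x"
    if "x \<in> extensional (cube n)" "y \<in> extensional (cube n)" for x y
    using that dual_antimono dual_dual by metis
  have dual_mbf_iff: "dual n x \<in> mbf n \<longleftrightarrow> x \<in> mbf n" if "x \<in> extensional (cube n)" for x
    using that dual_mbf dual_dual by metis
  have "assemble n (h, a, b, c, p, q, r, s) \<in> mbf (Suc (Suc (Suc (Suc n)))) \<longleftrightarrow>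
    h \<in> mbf n \<and> a \<in> mbf n \<and> b \<in> mbf n \<and> c \<in> mbf n \<and>
    p \<in> mbf n \<and> q \<in> mbf n \<and> r \<in> mbf n \<and> s \<in> mbf n \<and>
    p \<le> h \<and> q \<le> h \<and> r \<le> h \<and> s \<le> h \<and>
    a \<le> p \<and> b \<le> p \<and> c \<le> p \<and> a \<le> q \<and> dual n b \<le> q \<and> dual n c \<le> q \<and>
    b \<le> r \<and> dual n a \<le> r \<and> dual n c \<le> r \<and> c \<le> s \<and> dual n a \<le> s \<and> dual n b \<le> s"
    unfolding assemble_def
    by (simp add: glue_mbf_iff glue_le_iff ext dual_mbf_iff dual_le_dual_iff)
      (use flip flip' assms in blast)
  also have "\<dots> \<longleftrightarrow> (h, a, b, c, p, q, r, s) \<in> selfdual_data n"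
    (is "?covers \<longleftrightarrow> _")
  proof
    assume A: ?covers
    then have "a \<le> h" "b \<le> h" "c \<le> h" "dual n a \<le> h" "dual n b \<le> h" "dual n c \<le> h"
      by (meson order_trans)+
    moreover from this have "dual n h \<le> a" "dual n h \<le> b" "dual n h \<le> c"
      using flip assms by blast+
    moreover from calculation have "dual n h \<le> h"
      by (meson order_trans)
    ultimately show "(h, a, b, c, p, q, r, s) \<in> selfdual_data n"
      using A by (simp add: selfdual_data_def interval_def)
  qed (simp add: selfdual_data_def interval_def)
  finally show ?thesis .
qed

lemma selfdual_number_add_4:
  "selfdual_number (n + 4) = (\<Sum>h | h \<in> mbf n \<and> dual n h \<le> h. F n h)"
proof -
  let ?N = "Suc (Suc (Suc (Suc n)))"
  let ?E = "extensional (cube n)"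
  note glues = dual_glue glue_eq_iff glue_extensional dual_extensional dual_dual
  have ext: "h \<in> ?E \<and> a \<in> ?E \<and> b \<in> ?E \<and> c \<in> ?E \<and> p \<in> ?E \<and> q \<in> ?E \<and> r \<in> ?E \<and> s \<in> ?E"
    if "(h, a, b, c, p, q, r, s) \<in> selfdual_data n" for h a b c p q r s
    using that by (auto simp: selfdual_data_def interval_def intro: mbf_extensional)
  have inj: "inj_on (assemble n) (selfdual_data n)"
  proof (rule inj_onI)
    fix t u assume A: "t \<in> selfdual_data n" "u \<in> selfdual_data n" "assemble n t = assemble n u"
    obtain h a b c p q r s where t: "t = (h, a, b, c, p, q, r, s)"
      by (metis surj_pair)
    obtain h' a' b' c' p' q' r' s' where u: "u = (h', a', b', c', p', q', r', s')"
      by (metis surj_pair)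
    show "t = u"
      using A ext[of h a b c p q r s] ext[of h' a' b' c' p' q' r' s']
      unfolding t u assemble_def by (simp add: glues)
  qed
  have img: "assemble n ` selfdual_data n = {g \<in> mbf ?N. dual ?N g = g}"
  proof (intro equalityI subsetI)
    fix g assume "g \<in> assemble n ` selfdual_data n"
    then obtain h a b c p q r s where
      g: "g = assemble n (h, a, b, c, p, q, r, s)" and
      t: "(h, a, b, c, p, q, r, s) \<in> selfdual_data n"
      by auto
    have "dual ?N g = g"
      using ext[OF t] unfolding g assemble_def by (simp add: glues)
    then show "g \<in> {g \<in> mbf ?N. dual ?N g = g}"
      using g t ext[OF t] assemble_mbf_iff by auto
  next
    fix g assume "g \<in> {g \<in> mbf ?N. dual ?N g = g}"
    then have g: "g \<in> mbf ?N" and sd: "dual ?N g = g"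
      by auto
    obtain y0 y1 y2 y3 where
      y: "y0 \<in> extensional (cube (Suc (Suc n)))" "y1 \<in> extensional (cube (Suc (Suc n)))"
        "y2 \<in> extensional (cube (Suc (Suc n)))" "y3 \<in> extensional (cube (Suc (Suc n)))" and
      g_eq: "g = glue (Suc (Suc (Suc n))) (glue (Suc (Suc n)) y0 y1) (glue (Suc (Suc n)) y2 y3)"
      using mbf_extensional[OF g] by (rule extensional_Suc_Suc_cases)
    obtain x0 x1 x2 x3 where
      xa: "x0 \<in> ?E" "x1 \<in> ?E" "x2 \<in> ?E" "x3 \<in> ?E" and
      y0: "y0 = glue (Suc n) (glue n x0 x1) (glue n x2 x3)"
      using y(1) by (rule extensional_Suc_Suc_cases)
    obtain x4 x5 x6 x7 where
      xb: "x4 \<in> ?E" "x5 \<in> ?E" "x6 \<in> ?E" "x7 \<in> ?E" and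
      y1: "y1 = glue (Suc n) (glue n x4 x5) (glue n x6 x7)"
      using y(2) by (rule extensional_Suc_Suc_cases)
    obtain x8 x9 x10 x11 where
      xc: "x8 \<in> ?E" "x9 \<in> ?E" "x10 \<in> ?E" "x11 \<in> ?E" and
      y2: "y2 = glue (Suc n) (glue n x8 x9) (glue n x10 x11)"
      using y(3) by (rule extensional_Suc_Suc_cases)
    obtain x12 x13 x14 x15 where
      xd: "x12 \<in> ?E" "x13 \<in> ?E" "x14 \<in> ?E" "x15 \<in> ?E" and
      y3: "y3 = glue (Suc n) (glue n x12 x13) (glue n x14 x15)"
      using y(4) by (rule extensional_Suc_Suc_cases)
    \<comment> \<open>Complementing the last four coordinates reverses the list of the sixteen blocks.\<close>
    have "dual ?N g = g \<longleftrightarrow>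
      dual n x15 = x0 \<and> dual n x14 = x1 \<and> dual n x13 = x2 \<and> dual n x12 = x3 \<and>
      dual n x11 = x4 \<and> dual n x10 = x5 \<and> dual n x9 = x6 \<and> dual n x8 = x7 \<and>
      dual n x7 = x8 \<and> dual n x6 = x9 \<and> dual n x5 = x10 \<and> dual n x4 = x11 \<and>
      dual n x3 = x12 \<and> dual n x2 = x13 \<and> dual n x1 = x14 \<and> dual n x0 = x15"
      unfolding g_eq y0 y1 y2 y3 by (simp add: glues xa xb xc xd)
    with sd have dual_x: "dual n x15 = x0" "dual n x14 = x1" "dual n x13 = x2" "dual n x11 = x4"
      "dual n x7 = x8" "dual n x6 = x9" "dual n x5 = x10" "dual n x3 = x12"
      by blast+
    have g_assemble: "g = assemble n (x15, x3, x5, x6, x7, x11, x13, x14)"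
      unfolding g_eq y0 y1 y2 y3 assemble_def by (simp only: dual_x prod.case)
    have "(x15, x3, x5, x6, x7, x11, x13, x14) \<in> selfdual_data n"
      using g assemble_mbf_iff[OF xd(4) xa(4) xb(2) xb(3) xb(4) xc(4) xd(2) xd(3)]
      unfolding g_assemble by blast
    then show "g \<in> assemble n ` selfdual_data n"
      unfolding g_assemble by (rule imageI)
  qed
  have "n + 4 = ?N"
    by simp
  then have "selfdual_number (n + 4) = card {g \<in> mbf ?N. dual ?N g = g}"
    by (simp only: selfdual_number_def)
  also have "\<dots> = card (selfdual_data n)"
    using card_image[OF inj] by (simp only: img)
  finally show ?thesis
    by (simp only: card_selfdual_data)
qed

section \<open>Counting ones\<close>

lemma ones_Suc: "ones (Suc n) g = ones n (cofactor n False g) + ones n (cofactor n True g)"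
  by (simp add: ones_def)

lemma ones_mono: "g \<le> g' \<Longrightarrow> ones n g \<le> ones n g'"
proof (induction n arbitrary: g g')
  case 0
  then show ?case
    by (auto simp: ones_def le_fun_def)
next
  case (Suc n)
  then show ?case
    by (simp add: ones_Suc add_mono cofactor_mono)
qed

lemma ones_strict:
  assumes "g \<le> g'" "ones n g = ones n g'" "g \<in> extensional (cube n)" "g' \<in> extensional (cube n)"
  shows "g = g'"
  using assms
proof (induction n arbitrary: g g')
  case 0
  have "cube 0 = {\<lambda>_. undefined}"
    by (auto simp: cube_def)
  then show ?case
    using 0 by (intro extensionalityI[of _ "cube 0"]) (auto simp: ones_def split: if_splits)
next
  case (Suc n)
  have le: "cofactor n i g \<le> cofactor n i g'" for i
    using Suc.prems by (simp add: cofactor_mono)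
  have "ones n (cofactor n i g) = ones n (cofactor n i g')" for i
    using ones_mono[OF le, of n False] ones_mono[OF le, of n True] Suc.prems(2)
    by (cases i) (auto simp: ones_Suc)
  then have "cofactor n i g = cofactor n i g'" for i
    using Suc.IH le cofactor_extensional by blast
  then show ?case
    using Suc.prems glue_cofactor by metis
qed

lemma ones_dual: "ones n g + ones n (dual n g) = 2 ^ n"
proof -
  have "count_list (map Not xs) True = count_list xs False" for xs
    by (induction xs) auto
  moreover have "count_list xs True + count_list xs False = length xs" for xs
    by (induction xs) auto
  ultimately show ?thesis
    by (simp add: ones_def bits_dual length_bits)
qed

text \<open>
  Since \<open>\<ell>(h)\<close> and \<open>\<ell>(h\<^sup>*)\<close> add up to \<open>2\<^sup>n\<close>, exceeding half of \<open>2\<^sup>n\<close> means exceeding \<open>\<ell>(h\<^sup>*)\<close>.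
  The bound is a real power because \<open>2\<^sup>n\<^sup>-\<^sup>1\<close> is one half for \<open>n = 0\<close>.
\<close>

lemma ones_gt_half_iff:
  assumes "h \<in> mbf n" "dual n h \<le> h"
  shows "real (ones n h) > 2 powi (int n - 1) \<longleftrightarrow> dual n h \<noteq> h"
proof -
  have "(2::real) powi (int n - 1) = 2 ^ n / 2"
    by (simp add: power_int_diff)
  also have "\<dots> = real (ones n h + ones n (dual n h)) / 2"
    by (simp add: ones_dual)
  finally have "real (ones n h) > 2 powi (int n - 1) \<longleftrightarrow> ones n (dual n h) < ones n h"
    by auto
  also have "\<dots> \<longleftrightarrow> dual n h \<noteq> h"
    using assms ones_strict[of "dual n h" h n] ones_mono[of "dual n h" h n]
      mbf_extensional dual_extensional by fastforce
  finally show ?thesis .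
qed

lemma F_selfdual:
  assumes "h \<in> mbf n" "dual n h = h"
  shows "F n h = 1"
proof -
  have "{x \<in> mbf n. h \<le> x \<and> x \<le> h} = {h}"
    using assms by auto
  then show ?thesis
    using assms by (simp add: F_def re_def)
qed

section \<open>Permuting the coordinates\<close>

lemma permute_point_in_cube_iff:
  assumes "\<pi> permutes {1..n}"
  shows "permute_point \<pi> v \<in> cube n \<longleftrightarrow> v \<in> cube n"
proof -
  have "inv \<pi> permutes {1..n}"
    using assms by (rule permutes_inv)
  then have "inv \<pi> i = i" if "i \<notin> {1..n}" for i
    using that by (meson permutes_not_in)
  then show ?thesis
    by (auto simp: cube_def permute_point_def PiE_def extensional_def)
qed

lemma permute_fun_comp:
  assumes "\<pi> permutes {1..n}" "\<sigma> permutes {1..n}"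
  shows "permute_fun \<pi> (permute_fun \<sigma> g) = permute_fun (\<sigma> \<circ> \<pi>) g"
  using assms[THEN permutes_bij]
  by (auto simp: permute_fun_def permute_point_def fun_eq_iff o_inv_distrib o_assoc)

lemma permute_fun_id: "permute_fun id g = g"
  by (auto simp: permute_fun_def permute_point_def fun_eq_iff)

lemma permute_fun_inv:
  assumes "\<pi> permutes {1..n}"
  shows "permute_fun (inv \<pi>) (permute_fun \<pi> g) = g" "permute_fun \<pi> (permute_fun (inv \<pi>) g) = g"
  using assms permutes_inv[OF assms]
  by (simp_all add: permute_fun_comp permutes_inv_o permute_fun_id)

lemma permute_fun_mono: "f \<le> g \<Longrightarrow> permute_fun \<pi> f \<le> permute_fun \<pi> g"
  by (auto simp: permute_fun_def le_fun_def)

lemma permute_fun_le_iff: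
  assumes "\<pi> permutes {1..n}"
  shows "permute_fun \<pi> f \<le> permute_fun \<pi> g \<longleftrightarrow> f \<le> g"
  using permute_fun_mono permute_fun_inv[OF assms] by metis

lemma permute_fun_sup: "permute_fun \<pi> (sup f g) = sup (permute_fun \<pi> f) (permute_fun \<pi> g)"
  by (auto simp: permute_fun_def fun_eq_iff)

lemma permute_fun_dual:
  assumes "\<pi> permutes {1..n}"
  shows "permute_fun \<pi> (dual n g) = dual n (permute_fun \<pi> g)"
proof -
  have "neg_point n (permute_point \<pi> v) = permute_point \<pi> (neg_point n v)" for v
    using permutes_in_image[OF permutes_inv[OF assms]]
    by (simp add: permute_point_def neg_point_def fun_eq_iff restrict_def)
  then show ?thesis
    by (intro ext) (simp add: dual_eq permute_fun_def restrict_def permute_point_in_cube_iff[OF assms])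
qed

lemma permute_fun_mbf:
  assumes "\<pi> permutes {1..n}" "g \<in> mbf n"
  shows "permute_fun \<pi> g \<in> mbf n"
proof -
  have "permute_point \<pi> v \<le> permute_point \<pi> w" if "v \<le> w" for v w
    using that by (auto simp: permute_point_def le_fun_def)
  then have "mono_on (cube n) (permute_fun \<pi> g)"
    unfolding permute_fun_def comp_def
    using mbf_mono[OF assms(2)] permute_point_in_cube_iff[OF assms(1)] by (metis mono_onI)
  then show ?thesis
    using mbf_extensional[OF assms(2)] permute_point_in_cube_iff[OF assms(1)]
    by (simp add: mbf_def permute_fun_def PiE_def extensional_def)
qed

lemma bij_betw_permute_interval:
  assumes \<pi>: "\<pi> permutes {1..n}"
  shows "bij_betw (permute_fun \<pi>) (interval n x y)
    (interval n (permute_fun \<pi> x) (permute_fun \<pi> y))"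
proof (rule bij_betw_byWitness[where f' = "permute_fun (inv \<pi>)"])
  have \<pi>': "inv \<pi> permutes {1..n}"
    using \<pi> by (rule permutes_inv)
  show "permute_fun \<pi> ` interval n x y \<subseteq> interval n (permute_fun \<pi> x) (permute_fun \<pi> y)"
    unfolding interval_def using permute_fun_mbf[OF \<pi>] permute_fun_mono by blast
  show "permute_fun (inv \<pi>) ` interval n (permute_fun \<pi> x) (permute_fun \<pi> y) \<subseteq> interval n x y"
  proof
    fix z assume "z \<in> permute_fun (inv \<pi>) ` interval n (permute_fun \<pi> x) (permute_fun \<pi> y)"
    then obtain w where w: "w \<in> mbf n" "permute_fun \<pi> x \<le> w" "w \<le> permute_fun \<pi> y"
      and z: "z = permute_fun (inv \<pi>) w"
      unfolding interval_def by blast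
    have "x \<le> z" "z \<le> y"
      using w(2,3)[THEN permute_fun_mono, of "inv \<pi>"] by (simp_all only: z permute_fun_inv[OF \<pi>])
    then show "z \<in> interval n x y"
      using permute_fun_mbf[OF \<pi>' w(1)] z by (simp add: interval_def)
  qed
qed (simp_all add: permute_fun_inv[OF \<pi>])

lemma re_permute:
  assumes "\<pi> permutes {1..n}"
  shows "re n (permute_fun \<pi> x) (permute_fun \<pi> y) = re n x y"
  using bij_betw_same_card[OF bij_betw_permute_interval[OF assms]] by (simp add: re_eq_card)

text \<open>
  Everything in \<open>F\<close> is expressed by the order, the dual and the join, all preserved by the
  bijection \<open>permute_fun \<pi>\<close>; so the sum for \<open>\<pi>(h)\<close> is a reindexing of the sum for \<open>h\<close>.
\<close>

lemma F_permute:
  assumes \<pi>: "\<pi> permutes {1..n}"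
  shows "F n (permute_fun \<pi> h) = F n h"
proof -
  have bij: "bij_betw (permute_fun \<pi>) (interval n (dual n h) h)
      (interval n (dual n (permute_fun \<pi> h)) (permute_fun \<pi> h))"
    using bij_betw_permute_interval[OF \<pi>, of "dual n h" h] by (simp add: permute_fun_dual[OF \<pi>])
  show ?thesis
    unfolding F_def Let_def interval_def[symmetric]
    unfolding sum.reindex_bij_betw[OF bij, symmetric]
    unfolding permute_fun_dual[OF \<pi>, symmetric] permute_fun_sup[symmetric] re_permute[OF \<pi>] ..
qed

lemma equiv_mbf_equiv: "equiv (mbf n) (mbf_equiv n)"
proof (rule equivI)
  show "mbf_equiv n \<subseteq> mbf n \<times> mbf n"
    by (auto simp: mbf_equiv_def)
  show "refl_on (mbf n) (mbf_equiv n)"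
    unfolding refl_on_def mbf_equiv_def using permute_fun_id permutes_id by fastforce
  show "sym (mbf_equiv n)"
  proof (rule symI)
    fix f g assume "(f, g) \<in> mbf_equiv n"
    then show "(g, f) \<in> mbf_equiv n"
      using permute_fun_inv(1) permutes_inv by (force simp: mbf_equiv_def)
  qed
  show "trans (mbf_equiv n)"
  proof (rule transI)
    fix f g h assume "(f, g) \<in> mbf_equiv n" "(g, h) \<in> mbf_equiv n"
    then show "(f, h) \<in> mbf_equiv n"
      using permute_fun_comp permutes_compose by (fastforce simp: mbf_equiv_def)
  qed
qed

lemma class_subset: "C \<in> mbf_classes n \<Longrightarrow> C \<subseteq> mbf n"
  unfolding mbf_classes_def by (rule in_quotient_imp_subset[OF equiv_mbf_equiv])

lemma representative_in_class:
  assumes "C \<in> mbf_classes n"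
  shows "representative n C \<in> C"
  unfolding representative_def
proof (rule arg_min_if_finite(1))
  show "finite C"
    using class_subset[OF assms] finite_mbf by (rule finite_subset)
  show "C \<noteq> {}"
    using assms in_quotient_imp_non_empty[OF equiv_mbf_equiv] by (simp add: mbf_classes_def)
qed

text \<open>
  A class on which \<open>f\<close> is constant contributes its size times the value of \<open>f\<close> at any member, in
  particular at the chosen representative; \<open>P\<close> selects whole classes.
\<close>

lemma sum_over_classes:
  fixes f :: "boolfun \<Rightarrow> nat"
  assumes P: "\<And>g h. (g, h) \<in> mbf_equiv n \<Longrightarrow> P g \<longleftrightarrow> P h"
    and f: "\<And>g h. (g, h) \<in> mbf_equiv n \<Longrightarrow> f g = f h"
  shows "(\<Sum>C | C \<in> mbf_classes n \<and> P (representative n C).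
      class_size n (representative n C) * f (representative n C)) = (\<Sum>h | h \<in> mbf n \<and> P h. f h)"
proof -
  let ?E = "mbf_equiv n"
  let ?T = "{C \<in> mbf_classes n. P (representative n C)}"
  let ?S = "{h \<in> mbf n. P h}"
  note eq = equiv_mbf_equiv[of n]
  have cls: "?E `` {h} = C" if "C \<in> mbf_classes n" "h \<in> C" for h C
    using that quotientI equiv_class_eq[OF eq] unfolding mbf_classes_def by (fastforce elim!: quotientE)
  have rel: "(representative n C, h) \<in> ?E" if "C \<in> mbf_classes n" "h \<in> C" for h C
    using that cls[OF that(1) representative_in_class[OF that(1)]] by blast
  have fin: "finite ?T"
    using finite_quotient[OF finite_mbf, of ?E n] equiv_type[OF eq]
    by (simp add: mbf_classes_def)
  have "(\<Sum>h\<in>?S. f h) = (\<Sum>C\<in>?T. \<Sum>h | h \<in> ?S \<and> ?E `` {h} = C. f h)"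
  proof (rule sum.group[symmetric])
    show "(\<lambda>h. ?E `` {h}) ` ?S \<subseteq> ?T"
    proof
      fix C assume "C \<in> (\<lambda>h. ?E `` {h}) ` ?S"
      then obtain h where h: "h \<in> mbf n" "P h" "C = ?E `` {h}"
        by auto
      then have "C \<in> mbf_classes n" "h \<in> C"
        using equiv_class_self[OF eq] by (auto simp: mbf_classes_def quotientI)
      then show "C \<in> ?T"
        using P[OF rel] h by blast
    qed
  qed (use finite_mbf fin in auto)
  also have "\<dots> = (\<Sum>C\<in>?T. class_size n (representative n C) * f (representative n C))"
  proof (rule sum.cong[OF refl])
    fix C assume "C \<in> ?T"
    then have C: "C \<in> mbf_classes n" "P (representative n C)"
      by auto
    have "h \<in> ?S \<and> ?E `` {h} = C" if "h \<in> C" for h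
      using that C(2) class_subset[OF C(1)] cls[OF C(1) that] P[OF rel[OF C(1) that]] by blast
    moreover have "h \<in> C" if "h \<in> ?S" "?E `` {h} = C" for h
      using that equiv_class_self[OF eq] by blast
    ultimately have "{h \<in> ?S. ?E `` {h} = C} = C"
      by blast
    then have "(\<Sum>h | h \<in> ?S \<and> ?E `` {h} = C. f h) = (\<Sum>h\<in>C. f h)"
      by simp
    also have "\<dots> = (\<Sum>h\<in>C. f (representative n C))"
      using f[OF rel[OF C(1)]] by (intro sum.cong) auto
    also have "\<dots> = class_size n (representative n C) * f (representative n C)"
      using cls[OF C(1) representative_in_class[OF C(1)]] by (simp add: class_size_def)
    finally show "(\<Sum>h | h \<in> ?S \<and> ?E `` {h} = C. f h)
        = class_size n (representative n C) * f (representative n C)" .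
  qed
  finally show ?thesis
    by simp
qed

section \<open>The recursion\<close>

theorem mainTheorem3:
  fixes n :: nat
  shows "selfdual_number (n + 4) = selfdual_number n +
    (\<Sum>C | C \<in> mbf_classes n \<and>
           dual n (representative n C) \<le> representative n C \<and>
           real (ones n (representative n C)) > 2 powi (int n - 1).
       class_size n (representative n C) * F n (representative n C))"
proof -
  let ?P = "\<lambda>h. dual n h \<le> h \<and> dual n h \<noteq> h"
  have rep: "representative n C \<in> mbf n" if "C \<in> mbf_classes n" for C
    using that representative_in_class class_subset by blast
  have "selfdual_number (n + 4) =
      (\<Sum>h \<in> {h \<in> mbf n. dual n h = h} \<union> {h \<in> mbf n. ?P h}. F n h)"
    unfolding selfdual_number_add_4 by (intro sum.cong) auto
  also have "\<dots> = (\<Sum>h | h \<in> mbf n \<and> dual n h = h. F n h) + (\<Sum>h | h \<in> mbf n \<and> ?P h. F n h)"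
    by (intro sum.union_disjoint) (auto simp: finite_mbf)
  also have "(\<Sum>h | h \<in> mbf n \<and> dual n h = h. F n h) = selfdual_number n"
    by (simp add: selfdual_number_def F_selfdual)
  also have "(\<Sum>h | h \<in> mbf n \<and> ?P h. F n h) =
      (\<Sum>C | C \<in> mbf_classes n \<and> ?P (representative n C).
        class_size n (representative n C) * F n (representative n C))"
  proof (rule sum_over_classes[symmetric])
    fix g h assume "(g, h) \<in> mbf_equiv n"
    then obtain \<pi> where \<pi>: "\<pi> permutes {1..n}" and g: "g = permute_fun \<pi> h"
      by (auto simp: mbf_equiv_def)
    show "F n g = F n h"
      using F_permute[OF \<pi>] g by simp
    show "?P g \<longleftrightarrow> ?P h"
      using permute_fun_le_iff[OF \<pi>] permute_fun_inv(1)[OF \<pi>] permute_fun_dual[OF \<pi>] g by metis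
  qed
  also have "{C. C \<in> mbf_classes n \<and> ?P (representative n C)} =
      {C. C \<in> mbf_classes n \<and> dual n (representative n C) \<le> representative n C \<and>
        real (ones n (representative n C)) > 2 powi (int n - 1)}"
    using rep ones_gt_half_iff by auto
  finally show ?thesis .
qed

end
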